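(* Let $q$ be a prime power, $d$ a positive integer, and $\xi>0$ a real number with $d\geq 2\xi$. Then \[ \mathbb{E}_{\mathbb{M}}(\log \mathbf{T}) \geq \sum^{*}_{p\leq \xi}\frac{\log p}{p}\prod_{j=0}^{p-1}\Big(1-\frac{j}{q}\Big) - \sum^{*}_{p\leq \xi} \frac{\log p}{2p^{2}}\prod_{j=0}^{2p-1}\Big(1-\frac{j}{q}\Big), \] where $\sum^{*}$ indicates that the sums are restricted to prime numbers $p$.
   Context: $\Omega(q,d)$ is the set of all $q^d(q-1)$ polynomials of degree exactly $d$ in $\mathbb{F}_q[x]$, and $\mathbb{E}_{\mathbb{M}}$ denotes expectation with respect to the uniform probability measure on $\Omega(q,d)$. For $f\in\Omega(q,d)$, viewed as a map $\mathbb{F}_q\to\mathbb{F}_q$, the functional digraph $G_f$ has an edge from $v$ to $f(v)$ for each $v$; $\mathbf{T}(f)$ is the least common multiple of the lengths of the cycles of $G_f$ (equivalently the smallest positive integer $t$ with $f^{(n+t)}=f^{(n)}$ for all $n\ge q$, where $f^{(n)}$ is the $n$-fold compositional iterate). *)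

theory Defs
  imports
    "HOL-Probability.Probability"
    "HOL-Number_Theory.Prime_Powers"
    "HOL-Computational_Algebra.Polynomial"
    "Graph_Theory.Arc_Walk"
begin

(* Polynomials, not polynomial functions: distinct polynomials inducing the same map are
   counted separately.  The condition f \<noteq> 0 only matters for d = 0, as degree 0 = 0. *)
definition Omega :: "nat \<Rightarrow> 'a::{field,finite} poly set" where
  "Omega d = {f. f \<noteq> 0 \<and> degree f = d}"

definition functional_digraph :: "('a \<Rightarrow> 'a) \<Rightarrow> ('a, 'a \<times> 'a) pre_digraph" where
  "functional_digraph g =
     \<lparr>verts = UNIV, arcs = range (\<lambda>v. (v, g v)), tail = fst, head = snd\<rparr>"

(* A cycle is a nonempty closed walk (a list of arcs) without repeated vertices; its length is
   the number of its arcs.  Loops, i.e. fixed points of g, are cycles of length 1. *)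
definition cycle_lengths :: "('a \<Rightarrow> 'a) \<Rightarrow> nat set" where
  "cycle_lengths g = {length c |c. pre_digraph.cycle (functional_digraph g) c}"

definition T :: "'a::{field,finite} poly \<Rightarrow> nat" where
  "T f = Lcm (cycle_lengths (poly f))"

definition expectation_Omega :: "nat \<Rightarrow> ('a::{field,finite} poly \<Rightarrow> real) \<Rightarrow> real" where
  "expectation_Omega d X = measure_pmf.expectation (pmf_of_set (Omega d)) X"

(* pmf_of_set is only meaningful for finite nonempty sets. *)
lemma card_Omega:
  "card (Omega d :: 'a::{field,finite} poly set) = CARD('a) ^ d * (CARD('a) - 1)"
proof -
  let ?A = "{xs :: 'a list. length xs = d} \<times> (UNIV - {0 :: 'a})"
  have "xs = ys \<and> b = c"
    if "b \<noteq> 0" "c \<noteq> 0" "Poly (xs @ [b]) = Poly (ys @ [c])" for xs ys :: "'a list" and b c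
  proof -
    have "coeffs (Poly (xs @ [b])) = coeffs (Poly (ys @ [c]))" using that by simp
    with that(1,2) have "xs @ [b] = ys @ [c]"
      by (simp add: coeffs_Poly no_trailing_unfold del: Poly_snoc)
    then show ?thesis by simp
  qed
  then have inj: "inj_on (\<lambda>(xs, c). Poly (xs @ [c])) ?A"
    by (auto simp: inj_on_def simp del: Poly_snoc)
  have "Omega d = (\<lambda>(xs, c). Poly (xs @ [c])) ` ?A"
  proof (intro equalityI subsetI)
    fix f :: "'a poly"
    assume "f \<in> Omega d"
    then have f: "f \<noteq> 0" "degree f = d" by (auto simp: Omega_def)
    then have ne: "coeffs f \<noteq> []" by simp
    have "length (butlast (coeffs f)) = d"
      using f by (simp add: length_coeffs_degree)
    moreover have "last (coeffs f) \<noteq> 0"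
      using f(1) by (simp add: last_coeffs_eq_coeff_degree)
    moreover have "f = Poly (butlast (coeffs f) @ [last (coeffs f)])"
      using ne by (metis append_butlast_last_id Poly_coeffs)
    ultimately show "f \<in> (\<lambda>(xs, c). Poly (xs @ [c])) ` ?A"
      by (intro image_eqI[of _ _ "(butlast (coeffs f), last (coeffs f))"]) auto
  next
    fix f :: "'a poly"
    assume "f \<in> (\<lambda>(xs, c). Poly (xs @ [c])) ` ?A"
    then obtain xs c where f: "f = Poly (xs @ [c])" "length xs = d" "c \<noteq> 0" by auto
    then have "coeffs f = xs @ [c]"
      by (simp add: coeffs_Poly no_trailing_unfold del: Poly_snoc)
    then show "f \<in> Omega d"
      using f(2) by (auto simp: Omega_def degree_eq_length_coeffs)
  qed
  then have "card (Omega d :: 'a poly set) = card ?A"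
    using card_image[OF inj] by simp
  also have "card ?A = CARD('a) ^ d * (CARD('a) - 1)"
    using card_lists_length_eq[of "UNIV :: 'a set" d]
    by (simp add: card_cartesian_product card_Diff_subset)
  finally show ?thesis .
qed

lemma finite_Omega: "finite (Omega d :: 'a::{field,finite} poly set)"
  and Omega_nonempty: "(Omega d :: 'a::{field,finite} poly set) \<noteq> {}"
proof -
  have "card {0, 1 :: 'a} \<le> CARD('a)" by (rule card_mono) auto
  then have "card (Omega d :: 'a poly set) > 0" by (simp add: card_Omega)
  then show "finite (Omega d :: 'a poly set)" "(Omega d :: 'a poly set) \<noteq> {}"
    by (simp_all add: card_gt_0_iff)
qed

lemma wf_functional_digraph: "wf_digraph (functional_digraph g)"
  by unfold_locales (auto simp: functional_digraph_def)

(* On nat, Lcm of an infinite set is 0; this does not happen here. *)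
lemma T_pos: "T f > 0"
proof -
  have "n > 0 \<and> n \<le> card (range (\<lambda>v. (v, poly f v)))" if n: "n \<in> cycle_lengths (poly f)" for n
  proof -
    interpret wf_digraph "functional_digraph (poly f)" by (rule wf_functional_digraph)
    from n obtain c where c: "cycle c" "n = length c" by (auto simp: cycle_lengths_def)
    then obtain u where "awalk u c u" "distinct c" "c \<noteq> []" by (auto simp: cycle_conv)
    then show ?thesis
      using c(2) card_mono[of "range (\<lambda>v. (v, poly f v))" "set c"]
      by (auto simp: pre_digraph.awalk_def functional_digraph_def distinct_card)
  qed
  then have "finite (cycle_lengths (poly f))" "0 \<notin> cycle_lengths (poly f)"
    by (auto intro!: finite_subset[of _ "{..card (range (\<lambda>v. (v, poly f v)))}"])
  then show ?thesis by (metis T_def Lcm_0_iff gr0I)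
qed

end

theory Submission
  imports Defs
begin

text \<open>
  By interpolation, a random polynomial of degree \<open>d\<close> takes prescribed values at \<open>k \<le> d\<close> given
  points with probability exactly \<open>q\<^sup>-\<^sup>k\<close>.  Hence the first two factorial moments of the number \<open>N\<close>
  of cycles of length \<open>p\<close> agree with those of a random map as soon as \<open>2p \<le> d\<close>.  The probability
  that \<open>N \<ge> 1\<close> is bounded below through \<open>N - N (N - 1) / 2 \<le> 1\<close>, and \<open>log T\<close> is at least the sum of
  \<open>log p\<close> over the primes \<open>p\<close> which occur as a cycle length.
\<close>

section \<open>Interpolation\<close>

text \<open>Induction on the list of points. Let \<open>P\<close> be the monic polynomial vanishing
  exactly at the points of \<open>xs\<close>. Adding a multiple of \<open>P\<close> to
  \<open>f\<close> keeps the values at \<open>xs\<close>, keeps the degree because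
  \<open>degree P < d\<close>, and moves the value at the new point \<open>a\<close> by any desired
  amount since \<open>P\<close> does not vanish there. All values at \<open>a\<close> are therefore
  taken equally often.\<close>

lemma card_Omega_interpolate:
  assumes "distinct xs" "length ys = length xs" "length xs \<le> d"
  shows "card {f \<in> Omega d :: 'a::{field,finite} poly set. map (poly f) xs = ys} * CARD('a) ^ length xs
    = card (Omega d :: 'a poly set)"
  using assms
proof (induction xs arbitrary: ys)
  case Nil
  then show ?case by simp
next
  case (Cons a xs)
  then obtain b zs where ys: "ys = b # zs" "length zs = length xs"
    by (cases ys) auto
  define S where "S c = {f \<in> Omega d :: 'a poly set. map (poly f) xs = zs \<and> poly f a = c}" for c
  define P where "P = (\<Prod>x\<leftarrow>xs. [:- x, 1:])"
  have roots: "poly P x = 0 \<longleftrightarrow> x \<in> set xs" for x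
    unfolding P_def by (induction xs) auto
  have Pa: "poly P a \<noteq> 0" using Cons.prems(1) roots by auto
  have "degree P \<le> length xs"
    unfolding P_def by (rule order.trans[OF degree_prod_list_le]) (simp add: o_def sum_list_triv)
  then have degP: "degree P < d" using Cons.prems(3) by simp
  have Omega_add: "f + smult k P \<in> Omega d" if "f \<in> Omega d" for f k
  proof -
    have "degree (smult k P) < degree f"
      using that degP degree_smult_le[of k P] by (simp add: Omega_def)
    then have "degree (f + smult k P) = d"
      using that by (simp add: degree_add_eq_left Omega_def)
    moreover from this have "f + smult k P \<noteq> 0" using degP by auto
    ultimately show ?thesis by (simp add: Omega_def)
  qed
  have card_S: "card (S c) = card (S b)" for c
  proof -
    have vals: "map (poly (f + smult k P)) xs = map (poly f) xs" for f k
      using roots by auto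
    \<comment> \<open>The coefficient is chosen so that the summand contributes exactly
      \<open>c' - c\<close> at \<open>a\<close>.\<close>
    have shift: "f + smult ((c' - c) / poly P a) P \<in> S c'" if "f \<in> S c" for f c c'
      using that Pa vals Omega_add[of f] by (auto simp: S_def simp del: map_eq_conv)
    have cancel: "f + smult ((c' - c) / poly P a) P + smult ((c - c') / poly P a) P = f" for f c c'
      by (simp only: add.assoc smult_add_left[symmetric] add_divide_distrib[symmetric]) simp
    have "bij_betw (\<lambda>f. f + smult ((b - c) / poly P a) P) (S c) (S b)"
      by (rule bij_betw_byWitness[where f' = "\<lambda>f. f + smult ((c - b) / poly P a) P"])
        (use shift cancel in blast)+
    then show ?thesis by (rule bij_betw_same_card)
  qed
  have fin: "finite (S c)" for c
    unfolding S_def by (rule finite_subset[OF _ finite_Omega]) auto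
  have "{f \<in> Omega d. map (poly f) xs = zs} = (\<Union>c\<in>UNIV. S c)"
    by (auto simp: S_def)
  also have "card \<dots> = (\<Sum>c\<in>UNIV. card (S c))"
    by (rule card_UN_disjoint) (use fin in \<open>auto simp: S_def\<close>)
  also have "\<dots> = CARD('a) * card (S b)"
    by (simp add: sum.cong[OF refl card_S])
  finally have "card {f \<in> Omega d. map (poly f) xs = zs} = CARD('a) * card (S b)" .
  with Cons.IH[of zs] Cons.prems ys
  have "CARD('a) * card (S b) * CARD('a) ^ length xs = card (Omega d :: 'a poly set)"
    by simp
  moreover have "{f \<in> Omega d. map (poly f) (a # xs) = ys} = S b"
    by (auto simp: S_def ys)
  ultimately show ?case by (simp add: mult_ac)
qed

text \<open>Double counting: exchange the sums over \<open>f\<close> and \<open>xs\<close>, then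
  interpolate for each fixed list. The prescribed values \<open>h xs\<close> may depend on the list,
  which is how "the list is a cycle of \<open>f\<close>" becomes an interpolation condition.\<close>

lemma sum_card_interpolate:
  fixes L :: "'a::{field,finite} list set"
  assumes "finite L" "k \<le> d"
    and L: "\<And>xs. xs \<in> L \<Longrightarrow> distinct xs \<and> length xs = k \<and> length (h xs) = k"
  shows "(\<Sum>f\<in>Omega d. real (card {xs \<in> L. map (poly f) xs = h xs}))
    = real (card L) / real CARD('a) ^ k * real (card (Omega d :: 'a poly set))"
proof -
  have "(\<Sum>f\<in>Omega d. real (card {xs \<in> L. map (poly f) xs = h xs}))
      = (\<Sum>f\<in>Omega d. \<Sum>xs\<in>L. of_bool (map (poly f) xs = h xs))"
    using assms(1) by (simp add: of_bool_def sum.If_cases Int_def)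
  also have "\<dots> = (\<Sum>xs\<in>L. \<Sum>f\<in>Omega d. of_bool (map (poly f) xs = h xs))"
    by (rule sum.swap)
  also have "\<dots> = (\<Sum>xs\<in>L. real (card {f \<in> Omega d. map (poly f) xs = h xs}))"
    by (simp add: of_bool_def sum.If_cases Int_def finite_Omega)
  also have "\<dots> = (\<Sum>xs\<in>L. real (card (Omega d :: 'a poly set)) / real CARD('a) ^ k)"
  proof (rule sum.cong)
    fix xs assume "xs \<in> L"
    then have "card {f \<in> Omega d. map (poly f) xs = h xs} * CARD('a) ^ k
        = card (Omega d :: 'a poly set)"
      using card_Omega_interpolate[of xs "h xs" d] L[of xs] \<open>k \<le> d\<close> by simp
    from arg_cong[OF this, of real]
    have "real (card {f \<in> Omega d. map (poly f) xs = h xs}) * real CARD('a) ^ k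
        = real (card (Omega d :: 'a poly set))"
      by (simp only: of_nat_mult of_nat_power)
    then show "real (card {f \<in> Omega d. map (poly f) xs = h xs})
        = real (card (Omega d :: 'a poly set)) / real CARD('a) ^ k"
      by (simp add: field_simps)
  qed simp
  finally show ?thesis by simp
qed

lemma card_distinct_lists_over_power:
  fixes k :: nat
  assumes "k > 0"
  shows "real (card {xs :: 'a::finite list. length xs = k \<and> distinct xs}) / real CARD('a) ^ k
    = (\<Prod>j=0..k-1. 1 - real j / real CARD('a))"
proof (cases "k \<le> CARD('a)")
  case True
  let ?q = "CARD('a)"
  have "card {xs :: 'a list. length xs = k \<and> distinct xs} = \<Prod>{?q - k + 1..?q}"
    using card_lists_distinct_length_eq[of "UNIV :: 'a set" k] True by simp
  also have "\<dots> = (\<Prod>j=0..k-1. ?q - j)"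
    by (rule prod.reindex_bij_witness[of _ "\<lambda>j. ?q - j" "\<lambda>j. ?q - j"]) (use True assms in auto)
  finally have "real (card {xs :: 'a list. length xs = k \<and> distinct xs})
      = (\<Prod>j=0..k-1. real (?q - j))" by simp
  also have "\<dots> = (\<Prod>j=0..k-1. (1 - real j / real ?q) * real ?q)"
    by (rule prod.cong) (use True assms in \<open>auto simp: of_nat_diff field_simps\<close>)
  also have "\<dots> = (\<Prod>j=0..k-1. 1 - real j / real ?q) * real ?q ^ k"
    using assms by (simp add: prod.distrib)
  finally show ?thesis by simp
next
  case False
  have "card (set xs) \<le> CARD('a)" for xs :: "'a list"
    by (rule card_mono) auto
  \<comment> \<open>For \<open>k\<close> larger than the field both sides vanish: no list of length
    \<open>k\<close> has distinct entries, and the product contains the factor with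
    \<open>j = CARD('a)\<close>.\<close>
  then have "{xs :: 'a list. length xs = k \<and> distinct xs} = {}"
    using False by (force simp: distinct_card[symmetric])
  moreover have "(\<Prod>j=0..k-1. 1 - real j / real CARD('a)) = 0"
    by (rule prod_zero) (use False in \<open>auto intro!: bexI[of _ "CARD('a)"]\<close>)
  ultimately show ?thesis by (simp only: card.empty of_nat_0 div_0)
qed

section \<open>Cycles as cyclic sequences\<close>

text \<open>Each cycle of length \<open>p\<close> appears here \<open>p\<close> times, once for each starting point.\<close>

definition cyclic_seqs :: "('a \<Rightarrow> 'a) \<Rightarrow> nat \<Rightarrow> 'a list set" where
  "cyclic_seqs g p = {xs. length xs = p \<and> distinct xs \<and> map g xs = rotate1 xs}"

text \<open>With \<open>N\<close> cycles of length \<open>p > 0\<close> this set has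
  \<open>p^2 * N * (N - 1)\<close> elements. Disjointness excludes two rotations of the same cycle,
  and makes the concatenation of a pair a list with distinct entries, to which interpolation
  applies.\<close>

definition disjoint_cyclic_pairs :: "('a \<Rightarrow> 'a) \<Rightarrow> nat \<Rightarrow> ('a list \<times> 'a list) set" where
  "disjoint_cyclic_pairs g p =
     {(xs, ys). xs \<in> cyclic_seqs g p \<and> ys \<in> cyclic_seqs g p \<and> set xs \<inter> set ys = {}}"

lemma finite_cyclic_seqs: "finite (cyclic_seqs (g :: 'a::finite \<Rightarrow> 'a) p)"
  by (rule finite_subset[OF _ finite_lists_length_eq[of UNIV p]]) (auto simp: cyclic_seqs_def)

lemma rotate_in_cyclic_seqs: "xs \<in> cyclic_seqs g p \<Longrightarrow> rotate n xs \<in> cyclic_seqs g p"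
  by (simp add: cyclic_seqs_def rotate1_rotate_swap flip: rotate_map)

text \<open>A cyclic sequence is the forward orbit of its head, so the head determines it.\<close>

lemma nth_cyclic_seqs:
  assumes "xs \<in> cyclic_seqs g p" "i < p"
  shows "xs ! i = (g ^^ i) (hd xs)"
  using assms(2)
proof (induction i)
  case 0
  then show ?case using assms(1) by (auto simp: cyclic_seqs_def hd_conv_nth)
next
  case (Suc i)
  have "g (xs ! i) = rotate1 xs ! i"
    using assms(1) Suc.prems by (simp add: cyclic_seqs_def flip: nth_map[of i xs g])
  also have "\<dots> = xs ! Suc i"
    using assms(1) Suc.prems by (simp add: cyclic_seqs_def nth_rotate1)
  finally show ?case using Suc by simp
qed

lemma inj_on_hd_cyclic_seqs: "inj_on hd (cyclic_seqs g p)"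
proof (rule inj_onI)
  fix xs ys
  assume *: "xs \<in> cyclic_seqs g p" "ys \<in> cyclic_seqs g p" "hd xs = hd ys"
  then have "xs ! i = ys ! i" if "i < p" for i
    using that by (simp add: nth_cyclic_seqs)
  with * show "xs = ys" by (auto simp: cyclic_seqs_def intro: nth_equalityI)
qed

lemma cyclic_seqs_starting_at:
  assumes "xs \<in> cyclic_seqs g p" "x \<in> set xs"
  obtains zs where "zs \<in> cyclic_seqs g p" "hd zs = x" "set zs = set xs"
proof -
  from assms(2) obtain i where i: "i < length xs" "x = xs ! i"
    by (metis in_set_conv_nth)
  then have "hd (rotate i xs) = x" by (cases "xs = []") (auto simp: hd_rotate_conv_nth)
  then show thesis using that[of "rotate i xs"] assms(1) rotate_in_cyclic_seqs by auto
qed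

text \<open>Rotate both sequences to start at a common point; having the same head, they then
  coincide.\<close>

lemma cyclic_seqs_meeting_eq:
  assumes "xs \<in> cyclic_seqs g p" "ys \<in> cyclic_seqs g p" "set xs \<inter> set ys \<noteq> {}"
  shows "set xs = set ys"
proof -
  obtain x where x: "x \<in> set xs" "x \<in> set ys" using assms(3) by blast
  obtain xs' where xs': "xs' \<in> cyclic_seqs g p" "hd xs' = x" "set xs' = set xs"
    using cyclic_seqs_starting_at[OF assms(1) x(1)] .
  obtain ys' where ys': "ys' \<in> cyclic_seqs g p" "hd ys' = x" "set ys' = set ys"
    using cyclic_seqs_starting_at[OF assms(2) x(2)] .
  have "xs' = ys'"
    by (rule inj_onD[OF inj_on_hd_cyclic_seqs]) (use xs' ys' in auto)
  with xs' ys' show ?thesis by simp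
qed

text \<open>The sequences meeting \<open>xs\<close> run through the same cycle, one for each
  starting point, so \<open>hd\<close> maps them bijectively onto \<open>set xs\<close>.\<close>

lemma card_meeting_cyclic_seqs:
  assumes "xs \<in> cyclic_seqs g p" "p > 0"
  shows "card {ys \<in> cyclic_seqs g p. set xs \<inter> set ys \<noteq> {}} = p" (is "card ?R = p")
proof -
  have nonempty: "zs \<noteq> []" if "zs \<in> cyclic_seqs g p" for zs
    using that \<open>p > 0\<close> by (auto simp: cyclic_seqs_def)
  have "hd ` ?R = set xs"
  proof (intro equalityI subsetI)
    fix y assume "y \<in> hd ` ?R"
    then obtain ys where ys: "ys \<in> cyclic_seqs g p" "y = hd ys" "set xs \<inter> set ys \<noteq> {}"
      by auto
    then have "set xs = set ys" using cyclic_seqs_meeting_eq[OF assms(1)] by blast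
    then show "y \<in> set xs" using ys nonempty hd_in_set by metis
  next
    fix x assume x: "x \<in> set xs"
    obtain zs where "zs \<in> cyclic_seqs g p" "hd zs = x" "set zs = set xs"
      using cyclic_seqs_starting_at[OF assms(1) x] by blast
    then show "x \<in> hd ` ?R" using x by auto
  qed
  moreover have "card (hd ` ?R) = card ?R"
    by (rule card_image) (rule inj_on_subset[OF inj_on_hd_cyclic_seqs], auto)
  moreover have "card (set xs) = p"
    using assms(1) by (auto simp: cyclic_seqs_def distinct_card)
  ultimately show ?thesis by simp
qed

text \<open>Each sequence meets exactly \<open>p\<close> sequences, itself included, and is disjoint
  from all the others. For \<open>N\<close> cycles this is \<open>N * (N - 1) + N = N * N\<close>,
  scaled by \<open>p^2\<close>.\<close>

lemma card_disjoint_cyclic_pairs: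
  fixes g :: "'a::finite \<Rightarrow> 'a"
  assumes "p > 0"
  shows "card (disjoint_cyclic_pairs g p) + card (cyclic_seqs g p) * p
    = card (cyclic_seqs g p) * card (cyclic_seqs g p)"
proof -
  let ?C = "cyclic_seqs g p"
  have part: "card {ys \<in> ?C. set xs \<inter> set ys = {}} + p = card ?C" if "xs \<in> ?C" for xs
  proof -
    have "?C = {ys \<in> ?C. set xs \<inter> set ys = {}} \<union> {ys \<in> ?C. set xs \<inter> set ys \<noteq> {}}"
      by blast
    also have "card \<dots> = card {ys \<in> ?C. set xs \<inter> set ys = {}}
        + card {ys \<in> ?C. set xs \<inter> set ys \<noteq> {}}"
      by (rule card_Un_disjoint) (auto simp: finite_cyclic_seqs)
    finally show ?thesis using card_meeting_cyclic_seqs[OF that assms] by simp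
  qed
  have "disjoint_cyclic_pairs g p = (SIGMA xs:?C. {ys \<in> ?C. set xs \<inter> set ys = {}})"
    by (auto simp: disjoint_cyclic_pairs_def)
  then have "card (disjoint_cyclic_pairs g p) + card ?C * p
      = (\<Sum>xs\<in>?C. card {ys \<in> ?C. set xs \<inter> set ys = {}} + p)"
    by (simp add: card_SigmaI finite_cyclic_seqs sum.distrib)
  also have "\<dots> = card ?C * card ?C" using part by simp
  finally show ?thesis .
qed

text \<open>This stands in for the integrality of \<open>N\<close>: no value strictly between
  \<open>p\<close> and \<open>2 * p\<close> occurs, since two disjoint sequences already account for
  \<open>2 * p\<close> rotations.\<close>

lemma card_cyclic_seqs_gap:
  fixes g :: "'a::finite \<Rightarrow> 'a"
  assumes "p > 0"
  shows "card (cyclic_seqs g p) \<le> p \<or> 2 * p \<le> card (cyclic_seqs g p)"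
proof (rule disjCI)
  let ?C = "cyclic_seqs g p"
  let ?R = "\<lambda>xs. {ys \<in> ?C. set xs \<inter> set ys \<noteq> {}}"
  assume "\<not> 2 * p \<le> card ?C"
  show "card ?C \<le> p"
  proof (cases "?C = {}")
    case False
    then obtain xs where xs: "xs \<in> ?C" by blast
    have cR: "card (?R xs) = p" using card_meeting_cyclic_seqs[OF xs assms] .
    have "?C \<subseteq> ?R xs"
    proof (rule ccontr)
      assume "\<not> ?C \<subseteq> ?R xs"
      then obtain ys where ys: "ys \<in> ?C" "set xs \<inter> set ys = {}" by auto
      \<comment> \<open>A sequence meeting both \<open>xs\<close> and \<open>ys\<close> would have
        the same nonempty set of points as each of them.\<close>
      have "?R xs \<inter> ?R ys = {}"
        using cyclic_seqs_meeting_eq[OF xs] cyclic_seqs_meeting_eq[OF ys(1)] ys(2) by blast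
      then have "card (?R xs \<union> ?R ys) = 2 * p"
        using card_meeting_cyclic_seqs[OF ys(1) assms] cR
        by (subst card_Un_disjoint) (auto simp: finite_cyclic_seqs)
      moreover have "card (?R xs \<union> ?R ys) \<le> card ?C"
        by (rule card_mono) (auto simp: finite_cyclic_seqs)
      ultimately show False using \<open>\<not> 2 * p \<le> card ?C\<close> by simp
    qed
    then have "card ?C \<le> card (?R xs)"
      by (rule card_mono[rotated]) (simp add: finite_cyclic_seqs)
    with cR show ?thesis by simp
  qed simp
qed

lemma cyclic_seqs_nonempty_ge:
  fixes g :: "'a::finite \<Rightarrow> 'a"
  assumes "p > 0"
  shows "real (card (cyclic_seqs g p)) / real p
    - real (card (disjoint_cyclic_pairs g p)) / (2 * (real p)\<^sup>2)
    \<le> of_bool (cyclic_seqs g p \<noteq> {})"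
proof (cases "cyclic_seqs g p = {}")
  case True
  then show ?thesis by (simp add: disjoint_cyclic_pairs_def)
next
  case False
  define X where "X = card (cyclic_seqs g p)"
  obtain xs where xs: "xs \<in> cyclic_seqs g p" using False by blast
  have "card {ys \<in> cyclic_seqs g p. set xs \<inter> set ys \<noteq> {}} \<le> X"
    unfolding X_def by (rule card_mono) (auto simp: finite_cyclic_seqs)
  then have "X \<ge> p" using card_meeting_cyclic_seqs[OF xs assms] by simp
  then have "X = p \<or> 2 * p \<le> X"
    using card_cyclic_seqs_gap[OF assms, of g] by (auto simp: X_def)
  \<comment> \<open>With \<open>X = p * N\<close> this is \<open>(N - 1) * (N - 2) \<ge> 0\<close>,
    that is, \<open>N - N * (N - 1) / 2 \<le> 1\<close>, multiplied by \<open>p^2\<close>.\<close>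
  then have "(real X - real p) * (real X - 2 * real p) \<ge> 0"
  proof
    assume "2 * p \<le> X"
    then have "2 * real p \<le> real X" by (metis of_nat_le_iff of_nat_mult of_nat_numeral)
    then show ?thesis by (intro mult_nonneg_nonneg) auto
  qed simp
  moreover have "real (card (disjoint_cyclic_pairs g p)) = real X * real X - real X * real p"
    using card_disjoint_cyclic_pairs[OF assms, of g, folded X_def]
    by (metis add_diff_cancel_right' of_nat_add of_nat_mult)
  ultimately have "2 * real X * real p - real (card (disjoint_cyclic_pairs g p)) \<le> 2 * (real p)\<^sup>2"
    by (simp add: algebra_simps power2_eq_square)
  moreover have "real X / real p - real (card (disjoint_cyclic_pairs g p)) / (2 * (real p)\<^sup>2)
      = (2 * real X * real p - real (card (disjoint_cyclic_pairs g p))) / (2 * (real p)\<^sup>2)"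
    using assms by (simp add: field_simps power2_eq_square)
  ultimately show ?thesis using assms False by (simp add: X_def[symmetric] divide_le_eq)
qed

section \<open>Cycle lengths and their least common multiple\<close>

text \<open>The end point \<open>v\<close> is kept free because the tail of a closed walk is no
  longer closed, and the induction has to pass to tails. The closed case is
  \<open>v = hd xs\<close>.\<close>

lemma cas_functional_digraph:
  "xs \<noteq> [] \<Longrightarrow> map g xs = tl xs @ [v] \<Longrightarrow>
    pre_digraph.cas (functional_digraph g) (hd xs) (map (\<lambda>x. (x, g x)) xs) v"
proof (induction xs)
  case (Cons x xs)
  then show ?case
    by (cases xs) (auto simp: pre_digraph.cas.simps functional_digraph_def)
qed simp

lemma cyclic_seqs_imp_cycle_length:
  assumes "cyclic_seqs g p \<noteq> {}" "p > 0"
  shows "p \<in> cycle_lengths g"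
proof -
  interpret wf_digraph "functional_digraph g" by (rule wf_functional_digraph)
  obtain xs where xs: "length xs = p" "distinct xs" "map g xs = rotate1 xs"
    using assms(1) by (auto simp: cyclic_seqs_def)
  then have ne: "xs \<noteq> []" using assms(2) by auto
  let ?c = "map (\<lambda>x. (x, g x)) xs"
  have cas: "cas (hd xs) ?c (hd xs)"
    using cas_functional_digraph[of xs g "hd xs"] ne xs by (simp add: rotate1_hd_tl)
  have "awalk (hd xs) ?c (hd xs)"
    unfolding awalk_def using cas by (simp add: image_subset_iff) (auto simp: functional_digraph_def)
  \<comment> \<open>Dropping the start vertex from the vertices of the walk leaves the heads of its
    arcs, so the distinctness that \<open>cycle\<close> demands is that of
    \<open>rotate1 xs\<close>.\<close>
  moreover have "map (head (functional_digraph g)) ?c = rotate1 xs"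
    using xs(3) by (simp add: functional_digraph_def o_def)
  then have "distinct (tl (awalk_verts (hd xs) ?c))"
    using awalk_verts_conv'[OF cas] xs(2) ne by simp
  ultimately have "cycle ?c" using ne by (auto simp: cycle_def)
  then show ?thesis unfolding cycle_lengths_def using xs(1) by force
qed

lemma prod_primes_dvd:
  fixes n :: nat
  assumes "finite A" "\<And>p. p \<in> A \<Longrightarrow> prime p \<and> p dvd n"
  shows "\<Prod>A dvd n"
  using assms
proof (induction A rule: finite_induct)
  case (insert p A)
  have "coprime p (\<Prod>A)"
    by (rule prod_coprime_right) (use insert in \<open>auto intro: primes_coprime\<close>)
  then show ?case using insert by (simp add: divides_mult)
qed simp

text \<open>Distinct primes that occur as cycle lengths divide \<open>T f\<close>, hence so does
  their product. Positivity of \<open>T f\<close> turns this divisibility into an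
  inequality.\<close>

lemma ln_T_ge:
  assumes "finite A" "\<And>p. p \<in> A \<Longrightarrow> prime p"
  shows "(\<Sum>p\<in>A. ln (real p) * of_bool (cyclic_seqs (poly f) p \<noteq> {})) \<le> ln (real (T f))"
proof -
  let ?B = "{p \<in> A. cyclic_seqs (poly f) p \<noteq> {}}"
  have "p dvd T f" if "p \<in> ?B" for p
    using that assms(2)[of p] cyclic_seqs_imp_cycle_length[of "poly f" p]
    by (auto simp: T_def prime_gt_0_nat)
  then have "\<Prod>?B dvd T f"
    by (intro prod_primes_dvd) (use assms in auto)
  then have "\<Prod>?B \<le> T f" using T_pos by (rule dvd_imp_le)
  moreover have pos: "\<Prod>?B > 0" using assms(2) by (intro prod_pos) (auto simp: prime_gt_0_nat)
  ultimately have "ln (real (\<Prod>?B)) \<le> ln (real (T f))"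
    by (subst ln_le_cancel_iff) (simp_all only: of_nat_0_less_iff of_nat_le_iff T_pos)
  moreover have "ln (real (\<Prod>?B)) = (\<Sum>p\<in>?B. ln (real p))"
    unfolding of_nat_prod by (rule ln_prod) (use assms in \<open>auto simp: prime_gt_0_nat\<close>)
  moreover have "(\<Sum>p\<in>?B. ln (real p)) = (\<Sum>p\<in>A. ln (real p) * of_bool (cyclic_seqs (poly f) p \<noteq> {}))"
    by (rule sum.mono_neutral_cong_left) (use assms in auto)
  ultimately show ?thesis by simp
qed

section \<open>Expectations\<close>

lemma expectation_Omega_eq:
  fixes X :: "'a::{field,finite} poly \<Rightarrow> real"
  shows "expectation_Omega d X = (\<Sum>f\<in>Omega d. X f) / real (card (Omega d :: 'a poly set))"
  unfolding expectation_Omega_def by (rule integral_pmf_of_set[OF Omega_nonempty finite_Omega])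

lemma card_Omega_pos: "card (Omega d :: 'a::{field,finite} poly set) > 0"
  by (simp add: card_gt_0_iff Omega_nonempty finite_Omega)

text \<open>A distinct list \<open>xs\<close> of length \<open>p\<close> is cyclic exactly when
  \<open>f\<close> takes the values \<open>rotate1 xs\<close> on it: \<open>p\<close> interpolation
  conditions. No factor \<open>1 / p\<close> appears, as starting points are counted.\<close>

lemma expectation_card_cyclic_seqs:
  assumes "0 < p" "p \<le> d"
  shows "expectation_Omega d (\<lambda>f :: 'a::{field,finite} poly. real (card (cyclic_seqs (poly f) p)))
    = (\<Prod>j=0..p-1. 1 - real j / real CARD('a))"
proof -
  let ?L = "{xs :: 'a list. length xs = p \<and> distinct xs}"
  have "finite ?L"
    by (rule finite_subset[OF _ finite_lists_length_eq[of UNIV p]]) auto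
  then have "(\<Sum>f\<in>Omega d. real (card {xs \<in> ?L. map (poly f) xs = rotate1 xs}))
      = real (card ?L) / real CARD('a) ^ p * real (card (Omega d :: 'a poly set))"
    by (rule sum_card_interpolate) (use assms in auto)
  moreover have "{xs \<in> ?L. map (poly f) xs = rotate1 xs} = cyclic_seqs (poly f) p" for f :: "'a poly"
    by (auto simp: cyclic_seqs_def)
  ultimately show ?thesis
    unfolding expectation_Omega_eq card_distinct_lists_over_power[OF assms(1)]
    using card_Omega_pos[where 'a = 'a, of d] by simp
qed

text \<open>Concatenation encodes a pair as one distinct list of length \<open>2 * p\<close>, on
  which \<open>f\<close> must rotate each half separately. These are \<open>2 * p\<close>
  interpolation conditions, whence the bound on \<open>p\<close>.\<close>

lemma expectation_card_disjoint_cyclic_pairs: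
  assumes "0 < p" "2 * p \<le> d"
  shows "expectation_Omega d
      (\<lambda>f :: 'a::{field,finite} poly. real (card (disjoint_cyclic_pairs (poly f) p)))
    = (\<Prod>j=0..2*p-1. 1 - real j / real CARD('a))"
proof -
  let ?L = "{xs :: 'a list. length xs = 2 * p \<and> distinct xs}"
  let ?h = "\<lambda>zs :: 'a list. rotate1 (take p zs) @ rotate1 (drop p zs)"
  have fin: "finite ?L"
    by (rule finite_subset[OF _ finite_lists_length_eq[of UNIV "2 * p"]]) auto
  have card: "card (disjoint_cyclic_pairs (poly f) p) = card {zs \<in> ?L. map (poly f) zs = ?h zs}"
    for f :: "'a poly"
  proof (rule bij_betw_same_card)
    have split: "take p zs \<in> cyclic_seqs (poly f) p \<and> drop p zs \<in> cyclic_seqs (poly f) p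
        \<and> set (take p zs) \<inter> set (drop p zs) = {}"
      if zs: "length zs = 2 * p" "distinct zs" "map (poly f) zs = ?h zs" for zs
    proof -
      have "map (poly f) (take p zs) @ map (poly f) (drop p zs) = ?h zs"
        using zs(3) by (metis append_take_drop_id map_append)
      then have "map (poly f) (take p zs) = rotate1 (take p zs)"
        "map (poly f) (drop p zs) = rotate1 (drop p zs)"
        using zs(1) by (simp_all add: append_eq_append_conv)
      then show ?thesis
        using zs(1,2) by (auto simp: cyclic_seqs_def set_take_disj_set_drop_if_distinct)
    qed
    show "bij_betw (\<lambda>(xs, ys). xs @ ys) (disjoint_cyclic_pairs (poly f) p)
        {zs \<in> ?L. map (poly f) zs = ?h zs}"
      by (rule bij_betw_byWitness[where f' = "\<lambda>zs. (take p zs, drop p zs)"])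
        (use split in \<open>auto simp: disjoint_cyclic_pairs_def cyclic_seqs_def\<close>)
  qed
  have "(\<Sum>f\<in>Omega d. real (card {zs \<in> ?L. map (poly f) zs = ?h zs}))
      = real (card ?L) / real CARD('a) ^ (2 * p) * real (card (Omega d :: 'a poly set))"
    by (rule sum_card_interpolate) (use fin assms in auto)
  moreover have "0 < 2 * p" using assms by simp
  ultimately show ?thesis
    unfolding expectation_Omega_eq card[symmetric] card_distinct_lists_over_power[OF \<open>0 < 2 * p\<close>]
    using card_Omega_pos[where 'a = 'a, of d] by simp
qed

lemma expectation_cyclic_seqs_nonempty_ge:
  assumes "0 < p" "2 * p \<le> d"
  shows "(\<Prod>j=0..p-1. 1 - real j / real CARD('a)) / real p
      - (\<Prod>j=0..2*p-1. 1 - real j / real CARD('a)) / (2 * (real p)\<^sup>2)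
    \<le> expectation_Omega d (\<lambda>f :: 'a::{field,finite} poly. of_bool (cyclic_seqs (poly f) p \<noteq> {}))"
proof -
  have "(\<Prod>j=0..p-1. 1 - real j / real CARD('a)) / real p
      - (\<Prod>j=0..2*p-1. 1 - real j / real CARD('a)) / (2 * (real p)\<^sup>2)
    = expectation_Omega d (\<lambda>f :: 'a poly. real (card (cyclic_seqs (poly f) p)) / real p
        - real (card (disjoint_cyclic_pairs (poly f) p)) / (2 * (real p)\<^sup>2))"
    using assms
    by (simp only: expectation_card_cyclic_seqs[of p d, where 'a = 'a, symmetric]
        expectation_card_disjoint_cyclic_pairs[of p d, where 'a = 'a, symmetric])
      (simp add: expectation_Omega_eq sum_subtractf sum_divide_distrib[symmetric]
        diff_divide_distrib mult.commute)
  also have "\<dots> \<le> expectation_Omega d (\<lambda>f :: 'a poly. of_bool (cyclic_seqs (poly f) p \<noteq> {}))"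
    unfolding expectation_Omega_eq
    by (intro divide_right_mono sum_mono cyclic_seqs_nonempty_ge assms) simp
  finally show ?thesis .
qed

theorem theorem2:
  fixes q d :: nat and \<xi> :: real
  assumes "primepow q"
    and "CARD('a::{field,finite}) = q"
    and "d > 0"
    and "\<xi> > 0"
    and "real d \<ge> 2 * \<xi>"
  shows "expectation_Omega d (\<lambda>f :: 'a poly. ln (real (T f))) \<ge>
    (\<Sum>p | prime p \<and> real p \<le> \<xi>. ln (real p) / real p * (\<Prod>j=0..p-1. 1 - real j / real q))
    - (\<Sum>p | prime p \<and> real p \<le> \<xi>.
         ln (real p) / (2 * (real p)\<^sup>2) * (\<Prod>j=0..2*p-1. 1 - real j / real q))"
proof -
  define A where "A = {p :: nat. prime p \<and> real p \<le> \<xi>}"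
  define E where "E p = expectation_Omega d (\<lambda>f :: 'a poly. of_bool (cyclic_seqs (poly f) p \<noteq> {}))" for p
  have p: "prime p" "0 < p" "2 * p \<le> d" if "p \<in> A" for p
  proof -
    from that have "prime p" and "real p \<le> \<xi>" by (simp_all add: A_def)
    \<comment> \<open>The assumption \<open>d \<ge> 2 * \<xi>\<close> is what makes second moments
      available for every prime in the sum.\<close>
    with assms(5) have "real (2 * p) \<le> real d" by simp
    then show "2 * p \<le> d" by (simp only: of_nat_le_iff)
    show "prime p" "0 < p" using \<open>prime p\<close> by (simp_all add: prime_gt_0_nat)
  qed
  have "A \<subseteq> {..d}" using p(3) by force
  then have fin: "finite A" by (rule finite_subset) simp
  have "(\<Sum>p\<in>A. ln (real p) / real p * (\<Prod>j=0..p-1. 1 - real j / real q))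
      - (\<Sum>p\<in>A. ln (real p) / (2 * (real p)\<^sup>2) * (\<Prod>j=0..2*p-1. 1 - real j / real q))
    = (\<Sum>p\<in>A. ln (real p) * ((\<Prod>j=0..p-1. 1 - real j / real q) / real p
        - (\<Prod>j=0..2*p-1. 1 - real j / real q) / (2 * (real p)\<^sup>2)))"
    by (simp add: sum_subtractf right_diff_distrib)
  also have "\<dots> \<le> (\<Sum>p\<in>A. ln (real p) * E p)"
  proof (intro sum_mono mult_left_mono)
    fix p assume "p \<in> A"
    then show "(\<Prod>j=0..p-1. 1 - real j / real q) / real p
        - (\<Prod>j=0..2*p-1. 1 - real j / real q) / (2 * (real p)\<^sup>2) \<le> E p"
      using expectation_cyclic_seqs_nonempty_ge[of p d, where 'a = 'a] p assms(2)
      by (simp add: E_def)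
    show "0 \<le> ln (real p)" using p(2)[OF \<open>p \<in> A\<close>] by (intro ln_ge_zero) simp
  qed
  \<comment> \<open>Linearity of expectation alone: no independence between different primes is
    involved.\<close>
  also have "\<dots> = expectation_Omega d
      (\<lambda>f :: 'a poly. \<Sum>p\<in>A. ln (real p) * of_bool (cyclic_seqs (poly f) p \<noteq> {}))"
    unfolding E_def expectation_Omega_eq
    by (subst sum.swap) (simp add: sum_divide_distrib sum_distrib_left)
  also have "\<dots> \<le> expectation_Omega d (\<lambda>f :: 'a poly. ln (real (T f)))"
    unfolding expectation_Omega_eq
    by (intro divide_right_mono sum_mono ln_T_ge fin p(1)) simp_all
  finally show ?thesis by (simp add: A_def)
qed

end
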